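(* Let $Q=abcd$. For non-negative integers $N,M$ and $\nu,\mu\in\{0,1\}$ with $N+\nu\ge1$, $$\Phi_{2N+\nu,2M+\mu}(a,b,c,d)=\delta_{0\mu}(ac)^M\begin{bmatrix}N+M+\nu-1\\ M\end{bmatrix}_Q+\sum_{k=0}^{M+\mu-1}(ac)^k\begin{bmatrix}N+k+\nu-1\\ k\end{bmatrix}_Q\sum_{\substack{m_1,m_2,m_3,m_4\ge0\\ m_1+m_2+m_3+m_4=N}}\begin{bmatrix}M-k+m_4\\ m_4\end{bmatrix}_Q\begin{bmatrix}M-k+\mu-\nu\\ m_1\end{bmatrix}_Q(1+a\nu)a^{m_1}Q^{\binom{m_1+\nu}{2}}$$ $$\times\begin{bmatrix}M-k+\mu-1+m_2\\ m_2\end{bmatrix}_Q(ab)^{m_2}\begin{bmatrix}M-k\\ m_3\end{bmatrix}_Q(abc)^{m_3}Q^{\binom{m_3}{2}},$$ and, for non-negative integers $N,M$, $$\Psi_{N,M}(a,b,c,d)=\sum_{m=0}^{\lfloor M/2\rfloor}(-1)^m\sum_{k=0}^m\begin{bmatrix}\lfloor N/2\rfloor\\ k\end{bmatrix}_Q\begin{bmatrix}\lceil N/2\rceil\\ m-k\end{bmatrix}_Q(ac)^{m-k}Q^{k(k+1-m)+\binom{m}{2}}\Phi_{N,M-2m}(a,b,c,d).$$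
   Context: $\Phi_{N,M}(a,b,c,d)=\sum_\pi\omega^2_\pi(a,b,c,d)$ over all partitions $\pi$ with largest part $\le N$ and at most $M$ parts, and $\Psi_{N,M}(a,b,c,d)$ is the same sum restricted to partitions into distinct parts (empty partition included in both). The weight $\omega^2_\pi(a,b,c,d)$ is the product of labels when cells of each odd-indexed row of the Ferrers diagram (top row indexed 1) are labelled left to right alternately $a,b,\dots$ and cells of each even-indexed row alternately $c,d,\dots$. $\delta$ is the Kronecker delta. $\begin{bmatrix}n\\ k\end{bmatrix}_q=\frac{(q;q)_n}{(q;q)_k(q;q)_{n-k}}$ for $n\ge k\ge0$ and $0$ otherwise. *)

theory Defs
  imports Main
begin

text \<open>A partition is the weakly decreasing list of its (positive) parts.\<close>

definition is_partition :: "nat list \<Rightarrow> bool" where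
  "is_partition p \<longleftrightarrow> sorted_wrt (\<ge>) p \<and> (\<forall>x \<in> set p. 0 < x)"

definition box_partitions :: "nat \<Rightarrow> nat \<Rightarrow> nat list set" where
  "box_partitions N M = {p. is_partition p \<and> (\<forall>x \<in> set p. x \<le> N) \<and> length p \<le> M}"

text \<open>Rows and columns are counted from 0 here, so the top row and all other rows of odd index
  in the 1-based numbering are the rows \<open>i\<close> with \<open>even i\<close>.\<close>

definition cell_label :: "'a \<Rightarrow> 'a \<Rightarrow> 'a \<Rightarrow> 'a \<Rightarrow> nat \<Rightarrow> nat \<Rightarrow> 'a" where
  "cell_label a b c d i j =
     (if even i then (if even j then a else b) else (if even j then c else d))"

definition omega2 :: "'a::comm_monoid_mult \<Rightarrow> 'a \<Rightarrow> 'a \<Rightarrow> 'a \<Rightarrow> nat list \<Rightarrow> 'a" where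
  "omega2 a b c d p = (\<Prod>i<length p. \<Prod>j<p ! i. cell_label a b c d i j)"

definition Phi :: "nat \<Rightarrow> nat \<Rightarrow> 'a::comm_semiring_1 \<Rightarrow> 'a \<Rightarrow> 'a \<Rightarrow> 'a \<Rightarrow> 'a" where
  "Phi N M a b c d = (\<Sum>p \<in> box_partitions N M. omega2 a b c d p)"

definition Psi :: "nat \<Rightarrow> nat \<Rightarrow> 'a::comm_semiring_1 \<Rightarrow> 'a \<Rightarrow> 'a \<Rightarrow> 'a \<Rightarrow> 'a" where
  "Psi N M a b c d = (\<Sum>p \<in> {p \<in> box_partitions N M. distinct p}. omega2 a b c d p)"

lemma finite_box_partitions: "finite (box_partitions N M)"
  by (rule finite_subset[OF _ finite_lists_length_le[of "{..N}" M]])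
     (auto simp: box_partitions_def)

definition qpoch :: "'a::comm_ring_1 \<Rightarrow> 'a \<Rightarrow> nat \<Rightarrow> 'a" where
  "qpoch x q n = (\<Prod>i<n. 1 - x * q ^ i)"

text \<open>Integer arguments, so that no difference in an argument is truncated. The quotient is the
  Gaussian polynomial at \<open>q\<close> only if \<open>q ^ i \<noteq> 1\<close> for all \<open>i \<ge> 1\<close>.\<close>

definition qbinom :: "'a::field \<Rightarrow> int \<Rightarrow> int \<Rightarrow> 'a" where
  "qbinom q n k =
     (if 0 \<le> k \<and> k \<le> n
      then qpoch q q (nat n) / (qpoch q q (nat k) * qpoch q q (nat (n - k)))
      else 0)"

end

theory Submission
  imports Defs "HOL-Computational_Algebra.Formal_Power_Series"
begin

text \<open>For a predicate \<open>P\<close> on part sizes consider the partitions in which only parts satisfying \<open>P\<close>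
  may repeat: \<open>\<Phi>\<close> is the case where all parts may, \<open>\<Psi>\<close> the case where none may. Deleting a pair of
  equal rows keeps the labels of all other rows, so in the generating series over the bound on
  the number of parts, letting a part \<open>n\<close> repeat only multiplies by \<open>1 / (1 - X\<^sup>2 w)\<close>, where \<open>w\<close>
  is the weight of two rows of length \<open>n\<close>, namely \<open>Q\<^sup>j\<close> if \<open>n = 2j\<close> and \<open>ac Q\<^sup>j\<close> if \<open>n = 2j + 1\<close>.
  By the \<open>q\<close>-binomial theorem this expresses \<open>\<Psi>\<close> through \<open>\<Phi>\<close>, and \<open>\<Phi>\<close> through the sums over
  partitions with distinct odd parts. For the latter the generating series over the bound \<open>2N\<close> on
  the parts is a product, since removing the top row gives a first-order recursion; its four
  factors yield the sum over \<open>m\<^sub>1, m\<^sub>2, m\<^sub>3, m\<^sub>4\<close>.\<close>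

unbundle fps_syntax

section \<open>Partitions in which only some part sizes may repeat\<close>

text \<open>One relation governs both order and multiplicity: it is \<open>\<ge>\<close> if
  \<open>P\<close> holds everywhere and \<open>>\<close> if it holds nowhere, so both sums follow
  the same recursion.\<close>

definition rep_partitions :: "(nat \<Rightarrow> bool) \<Rightarrow> nat \<Rightarrow> nat \<Rightarrow> nat list set" where
  "rep_partitions P N M =
     {p. sorted_wrt (\<lambda>x y. y < x \<or> y = x \<and> P x) p \<and> set p \<subseteq> {1..N} \<and> length p \<le> M}"

definition rep_sum ::
    "(nat \<Rightarrow> bool) \<Rightarrow> 'a::comm_semiring_1 \<Rightarrow> 'a \<Rightarrow> 'a \<Rightarrow> 'a \<Rightarrow> nat \<Rightarrow> nat \<Rightarrow> 'a" where
  "rep_sum P a b c d N M = (\<Sum>p \<in> rep_partitions P N M. omega2 a b c d p)"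

definition row_weight :: "'a::comm_monoid_mult \<Rightarrow> 'a \<Rightarrow> nat \<Rightarrow> 'a" where
  "row_weight a b n = (\<Prod>j<n. if even j then a else b)"

lemma rep_partitions_all: "rep_partitions (\<lambda>_. True) N M = box_partitions N M"
proof -
  have "(\<lambda>x y. y < x \<or> y = x \<and> True) = (\<lambda>x y::nat. y \<le> x)"
    by (auto simp: fun_eq_iff)
  then show ?thesis
    unfolding rep_partitions_def box_partitions_def is_partition_def
    by (auto simp: Suc_le_eq subset_iff simp del: neq0_conv)
qed

lemma sorted_wrt_greater_iff:
  fixes p :: "'a::linorder list"
  shows "sorted_wrt (>) p \<longleftrightarrow> sorted_wrt (\<ge>) p \<and> distinct p"
  by (induction p) (auto simp: order_less_le)

lemma rep_partitions_none:
  "rep_partitions (\<lambda>_. False) N M = {p \<in> box_partitions N M. distinct p}"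
  unfolding rep_partitions_def box_partitions_def is_partition_def
  using sorted_wrt_greater_iff[where 'a=nat]
  by (auto simp: Suc_le_eq subset_iff simp del: neq0_conv)

lemma Phi_eq_rep_sum: "Phi N M a b c d = rep_sum (\<lambda>_. True) a b c d N M"
  by (simp add: Phi_def rep_sum_def rep_partitions_all)

lemma Psi_eq_rep_sum: "Psi N M a b c d = rep_sum (\<lambda>_. False) a b c d N M"
  by (simp add: Psi_def rep_sum_def rep_partitions_none)

lemma finite_rep_partitions [simp]: "finite (rep_partitions P N M)"
  by (rule finite_subset[OF _ finite_lists_length_le[of "{1..N}" M]])
     (auto simp: rep_partitions_def)

lemma rep_partitions_0 [simp]:
  "rep_partitions P 0 M = {[]}" "rep_partitions P N 0 = {[]}"
  by (auto simp: rep_partitions_def)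

text \<open>Case split on whether the top row has length \<open>Suc N\<close>; if so, the rows below
  may reach that length again only under \<open>P (Suc N)\<close>.\<close>

lemma rep_partitions_Suc_Suc:
  "rep_partitions P (Suc N) (Suc M) =
     rep_partitions P N (Suc M) \<union>
     Cons (Suc N) ` rep_partitions P (if P (Suc N) then Suc N else N) M"
    (is "?L = ?R")
proof (intro set_eqI iffI)
  fix p assume p: "p \<in> ?L"
  show "p \<in> ?R"
  proof (cases p)
    case Nil
    then show ?thesis by (simp add: rep_partitions_def)
  next
    case (Cons x q)
    with p have x: "x \<le> Suc N" "1 \<le> x" and q: "\<forall>y\<in>set q. 1 \<le> y \<and> (y < x \<or> y = x \<and> P x)"
      by (auto simp: rep_partitions_def)
    show ?thesis
    proof (cases "x = Suc N")
      case True
      with p q Cons have "q \<in> rep_partitions P (if P (Suc N) then Suc N else N) M"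
        by (auto simp: rep_partitions_def less_Suc_eq_le)
      with True Cons show ?thesis by blast
    next
      case False
      with x q have "\<forall>y\<in>set p. 1 \<le> y \<and> y \<le> N" unfolding Cons by fastforce
      with p show ?thesis by (auto simp: rep_partitions_def)
    qed
  qed
next
  fix p assume "p \<in> ?R"
  then show "p \<in> ?L"
    by (fastforce simp: rep_partitions_def le_Suc_eq subset_iff split: if_splits)
qed

lemma omega2_Nil [simp]: "omega2 a b c d [] = 1"
  by (simp add: omega2_def)

text \<open>Deleting the top row changes the parity of every other row index, so the label pairs
  \<open>a\<close>, \<open>b\<close> and \<open>c\<close>, \<open>d\<close> trade places.\<close>

lemma omega2_Cons: "omega2 a b c d (x # p) = row_weight a b x * omega2 c d a b p"
  unfolding omega2_def length_Cons prod.lessThan_Suc_shift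
  by (auto simp: row_weight_def cell_label_def intro!: arg_cong2[where f="(*)"] prod.cong)

lemma rep_sum_0 [simp]: "rep_sum P a b c d 0 M = 1" "rep_sum P a b c d N 0 = 1"
  by (simp_all add: rep_sum_def)

lemma rep_sum_Suc_Suc:
  "rep_sum P a b c d (Suc N) (Suc M) =
     rep_sum P a b c d N (Suc M) +
     row_weight a b (Suc N) * rep_sum P c d a b (if P (Suc N) then Suc N else N) M"
proof -
  let ?n = "if P (Suc N) then Suc N else N"
  have "rep_partitions P N (Suc M) \<inter> Cons (Suc N) ` rep_partitions P ?n M = {}"
    by (auto simp: rep_partitions_def)
  then have "rep_sum P a b c d (Suc N) (Suc M) =
      rep_sum P a b c d N (Suc M) +
      (\<Sum>p \<in> Cons (Suc N) ` rep_partitions P ?n M. omega2 a b c d p)"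
    unfolding rep_sum_def rep_partitions_Suc_Suc
    by (subst sum.union_disjoint) auto
  also have "(\<Sum>p \<in> Cons (Suc N) ` rep_partitions P ?n M. omega2 a b c d p) =
      row_weight a b (Suc N) * rep_sum P c d a b ?n M"
    by (subst sum.reindex) (auto simp: omega2_Cons rep_sum_def sum_distrib_left)
  finally show ?thesis .
qed

lemma row_weight_even: "row_weight a b (2 * n) = (a * b) ^ n"
  by (induction n) (auto simp: row_weight_def ac_simps)

lemma row_weight_odd: "row_weight a b (Suc (2 * n)) = a * (a * b) ^ n"
  using row_weight_even[of a b n] by (simp add: row_weight_def ac_simps)

section \<open>Generating series over the bound on the number of parts\<close>

definition rep_fps ::
    "(nat \<Rightarrow> bool) \<Rightarrow> 'a::comm_semiring_1 \<Rightarrow> 'a \<Rightarrow> 'a \<Rightarrow> 'a \<Rightarrow> nat \<Rightarrow> 'a fps" where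
  "rep_fps P a b c d n = Abs_fps (rep_sum P a b c d n)"

definition pair_weight :: "'a::comm_monoid_mult \<Rightarrow> 'a \<Rightarrow> 'a \<Rightarrow> 'a \<Rightarrow> nat \<Rightarrow> 'a" where
  "pair_weight a b c d n = row_weight a b n * row_weight c d n"

lemma rep_fps_0: "rep_fps P a b c d 0 = rep_fps P' a' b' c' d' 0"
  by (simp add: rep_fps_def fps_eq_iff)

lemma rep_fps_Suc:
  "rep_fps P a b c d (Suc n) = rep_fps P a b c d n +
     fps_X * fps_const (row_weight a b (Suc n)) *
       rep_fps P c d a b (if P (Suc n) then Suc n else n)"
proof (rule fps_ext)
  fix m
  show "rep_fps P a b c d (Suc n) $ m = (rep_fps P a b c d n +
     fps_X * fps_const (row_weight a b (Suc n)) *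
       rep_fps P c d a b (if P (Suc n) then Suc n else n)) $ m"
    by (cases m) (simp_all add: rep_fps_def rep_sum_Suc_Suc mult.assoc)
qed

text \<open>If \<open>Suc n\<close> may repeat, one step of the recursion leads to the same series
  with the labels exchanged, and a second step leads back. Solving for the series leaves on the
  right what the recursion gives when \<open>Suc n\<close> may not repeat.\<close>

lemma rep_fps_Suc_repeated:
  fixes a :: "'a::comm_ring_1"
  assumes "P (Suc n)"
  shows "(1 - fps_const (pair_weight a b c d (Suc n)) * fps_X ^ 2) * rep_fps P a b c d (Suc n) =
    rep_fps P a b c d n + fps_X * fps_const (row_weight a b (Suc n)) * rep_fps P c d a b n"
proof -
  have 1: "rep_fps P a b c d (Suc n) = rep_fps P a b c d n +
     fps_X * fps_const (row_weight a b (Suc n)) * rep_fps P c d a b (Suc n)"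
    and 2: "rep_fps P c d a b (Suc n) = rep_fps P c d a b n +
     fps_X * fps_const (row_weight c d (Suc n)) * rep_fps P a b c d (Suc n)"
    using rep_fps_Suc[of P _ _ _ _ n] assms by simp_all
  have "rep_fps P a b c d (Suc n) = rep_fps P a b c d n +
     fps_X * fps_const (row_weight a b (Suc n)) * (rep_fps P c d a b n +
     fps_X * fps_const (row_weight c d (Suc n)) * rep_fps P a b c d (Suc n))"
    using 1 unfolding 2[symmetric] .
  then show ?thesis
    by (simp add: algebra_simps power2_eq_square pair_weight_def
          flip: fps_const_mult)
qed

text \<open>Each size that may not repeat costs one factor relative to the unrestricted series. The
  labels vary in the induction because the recursion exchanges them.\<close>

lemma rep_fps_eq_prod:
  fixes a b c d :: "'a::field"
  shows "rep_fps P a b c d n =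
    (\<Prod>i | i < n \<and> \<not> P (Suc i). 1 - fps_const (pair_weight a b c d (Suc i)) * fps_X ^ 2) *
    rep_fps (\<lambda>_. True) a b c d n"
proof (induction n arbitrary: a b c d)
  case 0
  then show ?case by (simp add: rep_fps_0[of P a b c d "\<lambda>_. True" a b c d])
next
  case (Suc n)
  let ?f = "\<lambda>i. 1 - fps_const (pair_weight a b c d (Suc i)) * fps_X ^ 2"
  let ?D = "\<Prod>i | i < n \<and> \<not> P (Suc i). ?f i"
  let ?T = "rep_fps (\<lambda>_. True)" and ?W = "fps_X * fps_const (row_weight a b (Suc n))"
  \<comment> \<open>Two equal rows weigh the same whichever label pair comes first, so
    \<open>?D\<close> serves both label orders.\<close>
  have sym: "pair_weight c d a b = pair_weight a b c d"
    by (simp add: pair_weight_def fun_eq_iff mult.commute)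
  have IH: "rep_fps P a b c d n = ?D * ?T a b c d n" "rep_fps P c d a b n = ?D * ?T c d a b n"
    using Suc.IH[of a b c d] Suc.IH[of c d a b] by (simp_all add: sym)
  have T: "?f n * ?T a b c d (Suc n) = ?T a b c d n + ?W * ?T c d a b n"
    by (rule rep_fps_Suc_repeated) simp
  \<comment> \<open>The left side is the wanted series if \<open>Suc n\<close> may not repeat, and
    \<open>?f n\<close> times it otherwise.\<close>
  have key: "rep_fps P a b c d n + ?W * rep_fps P c d a b n = ?D * ?f n * ?T a b c d (Suc n)"
    unfolding IH mult.assoc T by (simp add: algebra_simps)
  show ?case
  proof (cases "P (Suc n)")
    case True
    then have "{i. i < Suc n \<and> \<not> P (Suc i)} = {i. i < n \<and> \<not> P (Suc i)}"
      by (auto simp: less_Suc_eq)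
    moreover have "?f n * rep_fps P a b c d (Suc n) = ?f n * (?D * ?T a b c d (Suc n))"
      using rep_fps_Suc_repeated[of P n a b c d] True key by (simp add: ac_simps)
    \<comment> \<open>Power series over a field form an integral domain, so \<open>?f n\<close>,
      with constant term 1, can be cancelled.\<close>
    moreover have "?f n \<noteq> 0"
    proof
      assume "?f n = 0"
      then have "?f n $ 0 = 0" by simp
      then show False by (simp add: power2_eq_square mult.assoc)
    qed
    ultimately show ?thesis by simp
  next
    case False
    then have "{i. i < Suc n \<and> \<not> P (Suc i)} = insert n {i. i < n \<and> \<not> P (Suc i)}"
      by (auto simp: less_Suc_eq)
    with False key show ?thesis
      by (simp add: rep_fps_Suc[of P] ac_simps)
  qed
qed

section \<open>Coefficients of products of series\<close>

lemma fps_compose_X_square_nth: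
  fixes f :: "'a::comm_ring_1 fps"
  shows "(f oo fps_X ^ 2) $ n = (if even n then f $ (n div 2) else 0)"
proof -
  have "(f oo fps_X ^ 2) $ n = (\<Sum>i=0..n. if i = n div 2 \<and> even n then f $ i else 0)"
    unfolding fps_compose_nth
    by (intro sum.cong refl) (auto simp: fps_X_power_nth simp flip: power_mult)
  also have "\<dots> = (if even n then f $ (n div 2) else 0)"
    by (cases "even n") (simp_all add: sum.delta)
  finally show ?thesis .
qed

text \<open>A pair of rows uses up two of the rows allowed, so factors for pairs are series in
  \<open>X\<^sup>2\<close>; here \<open>m\<close> counts pairs and \<open>n - 2 * m\<close> is the
  remaining bound, never truncated.\<close>

lemma fps_compose_X_square_mult_nth:
  fixes f g :: "'a::comm_ring_1 fps"
  shows "((f oo fps_X ^ 2) * g) $ n = (\<Sum>m=0..n div 2. f $ m * g $ (n - 2 * m))"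
proof -
  have "((f oo fps_X ^ 2) * g) $ n = (\<Sum>i | i \<le> n \<and> even i. f $ (i div 2) * g $ (n - i))"
    unfolding fps_mult_nth fps_compose_X_square_nth
    by (rule sum.mono_neutral_cong_right) auto
  also have "\<dots> = (\<Sum>m=0..n div 2. f $ m * g $ (n - 2 * m))"
    by (rule sum.reindex_bij_witness[of _ "\<lambda>m. 2 * m" "\<lambda>i. i div 2"]) auto
  finally show ?thesis .
qed

lemma fps_mult4_nth:
  fixes F1 F2 F3 F4 :: "'a::comm_semiring_1 fps"
  shows "(F1 * F2 * F3 * F4) $ N =
    (\<Sum>(m1, m2, m3, m4) \<in> {(m1, m2, m3, m4). m1 + m2 + m3 + m4 = N}.
       F1 $ m1 * F2 $ m2 * F3 $ m3 * F4 $ m4)"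
proof -
  have "(F1 * F2 * F3 * F4) $ N = (F1 * (F2 * (F3 * F4))) $ N"
    by (simp add: mult.assoc)
  also have "\<dots> = (\<Sum>m1=0..N. \<Sum>m2=0..N - m1. \<Sum>m3=0..N - m1 - m2.
      F1 $ m1 * F2 $ m2 * F3 $ m3 * F4 $ (N - m1 - m2 - m3))"
    by (simp add: fps_mult_nth sum_distrib_left mult.assoc)
  also have "\<dots> = (\<Sum>(m1, m2, m3) \<in> (SIGMA m1:{0..N}. SIGMA m2:{0..N - m1}. {0..N - m1 - m2}).
      F1 $ m1 * F2 $ m2 * F3 $ m3 * F4 $ (N - m1 - m2 - m3))"
    by (simp add: sum.Sigma)
  also have "\<dots> = (\<Sum>(m1, m2, m3, m4) \<in> {(m1, m2, m3, m4). m1 + m2 + m3 + m4 = N}.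
       F1 $ m1 * F2 $ m2 * F3 $ m3 * F4 $ m4)"
    by (rule sum.reindex_bij_witness[of _ "\<lambda>(m1, m2, m3, m4). (m1, m2, m3)"
          "\<lambda>(m1, m2, m3). (m1, m2, m3, N - m1 - m2 - m3)"]) auto
  finally show ?thesis .
qed

section \<open>Gaussian binomials and the q-binomial theorem\<close>

text \<open>The factors are \<open>1 - q ^ Suc i\<close>, so genericity of \<open>q\<close> keeps
  the denominators in \<open>qbinom\<close> nonzero.\<close>

lemma qpoch_self_nonzero:
  fixes q :: "'a::field"
  assumes "\<And>n::nat. 1 \<le> n \<Longrightarrow> q ^ n \<noteq> 1"
  shows "qpoch q q n \<noteq> 0"
  using assms by (auto simp: qpoch_def simp flip: power_Suc)

lemma qbinom_0_right:
  assumes "\<And>n::nat. 1 \<le> n \<Longrightarrow> q ^ n \<noteq> 1"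
  shows "qbinom q (int n) 0 = 1"
  using qpoch_self_nonzero[OF assms] by (simp add: qbinom_def qpoch_def)

lemma qbinom_eq_0: "n < k \<Longrightarrow> qbinom q n k = 0"
  by (simp add: qbinom_def)

text \<open>The q-Pascal rule. It comes from \<open>1 - q ^ Suc n = (1 - q ^ (n - k)) + q ^ (n - k)
  * (1 - q ^ Suc k)\<close>.\<close>

lemma qbinom_Suc_Suc:
  fixes q :: "'a::field"
  assumes q: "\<And>n::nat. 1 \<le> n \<Longrightarrow> q ^ n \<noteq> 1" and "k \<le> n"
  shows "qbinom q (int (Suc n)) (int (Suc k)) =
    qbinom q (int n) (int (Suc k)) + q ^ (n - k) * qbinom q (int n) (int k)"
\<comment> \<open>For \<open>k = n\<close> the first term on the right is 0 by convention and not
  given by the quotient.\<close>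
proof (cases "k = n")
  case True
  then show ?thesis
    using qpoch_self_nonzero[OF q, of n] qpoch_self_nonzero[OF q, of "Suc n"]
    by (simp add: qbinom_def qpoch_def[of _ _ 0] del: of_nat_Suc)
next
  case False
  with \<open>k \<le> n\<close> obtain r where n: "n = k + Suc r"
    using less_imp_Suc_add[of k n] by auto
  have Suc: "qpoch q q (Suc j) = qpoch q q j * (1 - q ^ Suc j)" for j
    by (simp add: qpoch_def)
  have nat: "qbinom q (int m) (int j) = qpoch q q m / (qpoch q q j * qpoch q q (m - j))"
    if "j \<le> m" for m j
    using that by (simp add: qbinom_def nat_diff_distrib)
  have nz: "qpoch q q j \<noteq> 0" "1 - q ^ Suc j \<noteq> 0" for j
    using qpoch_self_nonzero[OF q] q[of "Suc j"] by auto
  have diffs: "Suc n - Suc k = Suc r" "n - Suc k = r" "n - k = Suc r"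
    using n by auto
  have pow: "q ^ Suc n = q ^ Suc r * q ^ Suc k"
    by (simp add: n power_add)
  have le: "Suc k \<le> Suc n" "Suc k \<le> n" "k \<le> n" using n by auto
  show ?thesis
    unfolding le[THEN nat] diffs Suc[of n] Suc[of k] Suc[of r] pow
    using nz(1)[of n] nz(1)[of k] nz(1)[of r] nz(2)[of k] nz(2)[of r]
    by (simp add: divide_simps del: power_Suc) (simp add: algebra_simps del: power_Suc)
qed

lemma choose_2_Suc: "Suc k choose 2 = k + (k choose 2)"
  by (simp add: numeral_2_eq_2)

text \<open>The q-shifted factorial \<open>(yX; q)\<^sub>n\<close> with \<open>X\<close> the formal
  variable.\<close>

definition fps_qpoch :: "'a::comm_ring_1 \<Rightarrow> 'a \<Rightarrow> nat \<Rightarrow> 'a fps" where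
  "fps_qpoch y q n = (\<Prod>i<n. 1 - fps_const (y * q ^ i) * fps_X)"

lemma fps_qpoch_0 [simp]: "fps_qpoch y q 0 = 1"
  by (simp add: fps_qpoch_def)

text \<open>Splitting off the first factor suits recursions that replace \<open>y\<close> by
  \<open>y * q\<close>.\<close>

lemma fps_qpoch_Suc_left:
  "fps_qpoch y q (Suc n) = (1 - fps_const y * fps_X) * fps_qpoch (y * q) q n"
  unfolding fps_qpoch_def prod.lessThan_Suc_shift by (simp add: mult.assoc)

lemma fps_one_minus_X_mult_nth:
  fixes f :: "'a::comm_ring_1 fps"
  shows "((1 - fps_const c * fps_X) * f) $ 0 = f $ 0"
    and "((1 - fps_const c * fps_X) * f) $ Suc k = f $ Suc k - c * f $ k"
  by (simp_all add: left_diff_distrib mult.assoc)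

text \<open>Induction on \<open>n\<close> with the last factor split off. Since
  \<open>q ^ n = q ^ (n - j) * q ^ j\<close>, the part \<open>q ^ j\<close> turns
  \<open>j choose 2\<close> into \<open>Suc j choose 2\<close> and the rest is the q-Pascal
  rule.\<close>

lemma qbinomial_theorem:
  fixes q y :: "'a::field"
  assumes q: "\<And>n::nat. 1 \<le> n \<Longrightarrow> q ^ n \<noteq> 1"
  shows "fps_qpoch y q n =
    Abs_fps (\<lambda>k. qbinom q (int n) (int k) * (- y) ^ k * q ^ (k choose 2))"
proof (induction n)
  case 0
  show ?case
    by (rule fps_ext) (use qbinom_0_right[OF q, of 0] in \<open>auto simp: qbinom_eq_0 numeral_2_eq_2\<close>)
next
  case (Suc n)
  let ?A = "\<lambda>n. Abs_fps (\<lambda>k. qbinom q (int n) (int k) * (- y) ^ k * q ^ (k choose 2))"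
  have step: "fps_qpoch y q (Suc n) =
      (1 - fps_const (y * q ^ n) * fps_X) * ?A n"
    using Suc.IH by (simp add: fps_qpoch_def mult.commute)
  show ?case
  proof (rule fps_ext)
    fix k
    show "fps_qpoch y q (Suc n) $ k = ?A (Suc n) $ k"
    proof (cases k)
      case 0
      then show ?thesis
        using qbinom_0_right[OF q, of n] qbinom_0_right[OF q, of "Suc n"]
        unfolding step by (simp add: fps_one_minus_X_mult_nth del: of_nat_Suc)
    next
      case (Suc j)
      have "fps_qpoch y q (Suc n) $ k =
          qbinom q (int n) (int (Suc j)) * (- y) ^ Suc j * q ^ (Suc j choose 2) -
          y * q ^ n * (qbinom q (int n) (int j) * (- y) ^ j * q ^ (j choose 2))"
        unfolding step Suc fps_one_minus_X_mult_nth fps_nth_Abs_fps ..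
      also have "\<dots> = qbinom q (int (Suc n)) (int (Suc j)) * (- y) ^ Suc j * q ^ (Suc j choose 2)"
      proof (cases "j \<le> n")
        case True
        then have "q ^ n = q ^ (n - j) * q ^ j" by (simp flip: power_add)
        moreover have "qbinom q (int (Suc n)) (int (Suc j)) =
            qbinom q (int n) (int (Suc j)) + q ^ (n - j) * qbinom q (int n) (int j)"
          using q True by (rule qbinom_Suc_Suc)
        ultimately show ?thesis
          by (simp only: choose_2_Suc power_add power_Suc) (simp add: algebra_simps del: of_nat_Suc)
      qed (simp add: qbinom_eq_0)
      finally show ?thesis using Suc by simp
    qed
  qed
qed

text \<open>The expansion of \<open>1 / (yX; q)\<^sub>n\<close>. For \<open>n = 0\<close> it would
  fail: the constant coefficient is then \<open>qbinom q (- 1) 0\<close>, which is 0 by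
  convention.\<close>

lemma qbinomial_theorem_inverse:
  fixes q y :: "'a::field"
  assumes q: "\<And>n::nat. 1 \<le> n \<Longrightarrow> q ^ n \<noteq> 1" and "1 \<le> n"
  shows "fps_qpoch y q n *
    Abs_fps (\<lambda>k. qbinom q (int n + int k - 1) (int k) * y ^ k) = 1"
  using \<open>1 \<le> n\<close>
proof (induction n rule: dec_induct)
  case base
  have "qbinom q (int k) (int k) = 1" for k
    using qpoch_self_nonzero[OF q, of k] by (simp add: qbinom_def qpoch_def[of _ _ 0])
  then have "(1 - fps_const y * fps_X) * Abs_fps (\<lambda>k. qbinom q (int k) (int k) * y ^ k) = 1"
    by (intro fps_ext, rename_tac k, case_tac k)
       (simp_all only: fps_one_minus_X_mult_nth fps_nth_Abs_fps, simp_all)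
  then show ?case by (simp add: fps_qpoch_def)
next
  case (step n)
  let ?B = "\<lambda>n. Abs_fps (\<lambda>k. qbinom q (int n + int k - 1) (int k) * y ^ k)"
  \<comment> \<open>The last factor lowers \<open>n\<close> by one; this is the q-Pascal rule with
    upper entry \<open>n + j\<close>, where \<open>n = (n + j) - j\<close>.\<close>
  have "(1 - fps_const (y * q ^ n) * fps_X) * ?B (Suc n) = ?B n"
  proof (rule fps_ext)
    fix k
    show "((1 - fps_const (y * q ^ n) * fps_X) * ?B (Suc n)) $ k = ?B n $ k"
    proof (cases k)
      case 0
      have 1: "int n + int 0 - 1 = int (n - 1)" "int (Suc n) + int 0 - 1 = int n"
        using step by simp_all
      then show ?thesis
        unfolding 0 fps_one_minus_X_mult_nth fps_nth_Abs_fps 1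
        using qbinom_0_right[OF q, of n] qbinom_0_right[OF q, of "n - 1"]
        by (simp del: of_nat_Suc of_nat_diff)
    next
      case (Suc j)
      have 1: "int (Suc n) + int (Suc j) - 1 = int (Suc (n + j))"
        "int n + int (Suc j) - 1 = int (n + j)" "int (Suc n) + int j - 1 = int (n + j)"
        by simp_all
      have "((1 - fps_const (y * q ^ n) * fps_X) * ?B (Suc n)) $ k =
        qbinom q (int (Suc (n + j))) (int (Suc j)) * y ^ Suc j -
        y * q ^ n * (qbinom q (int (n + j)) (int j) * y ^ j)"
        unfolding Suc fps_one_minus_X_mult_nth fps_nth_Abs_fps 1 ..
      also have "\<dots> = qbinom q (int (n + j)) (int (Suc j)) * y ^ Suc j"
        using qbinom_Suc_Suc[OF q, of j "n + j"] by (simp add: algebra_simps del: of_nat_Suc of_nat_add)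
      finally show ?thesis
        unfolding Suc fps_nth_Abs_fps 1 .
    qed
  qed
  with step.IH show ?case by (simp add: fps_qpoch_def mult.assoc del: of_nat_Suc)
qed

section \<open>The factors for pairs as q-shifted factorials\<close>

lemma pair_weight_odd: "pair_weight a b c d (Suc (2 * j)) = a * c * (a * b * c * d) ^ j"
  unfolding pair_weight_def row_weight_odd by (simp add: power_mult_distrib ac_simps)

lemma pair_weight_even: "pair_weight a b c d (2 * j) = (a * b * c * d) ^ j"
  unfolding pair_weight_def row_weight_even by (simp add: power_mult_distrib ac_simps)

text \<open>Writing the factors as a composition with \<open>X\<^sup>2\<close> lets the q-binomial
  theorem, stated in \<open>X\<close>, apply to them.\<close>

lemma rep_fps_eq_compose:
  fixes a b c d :: "'a::field"
  shows "rep_fps P a b c d n =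
    ((\<Prod>i | i < n \<and> \<not> P (Suc i). 1 - fps_const (pair_weight a b c d (Suc i)) * fps_X)
       oo fps_X ^ 2) * rep_fps (\<lambda>_. True) a b c d n"
proof -
  have "(1 - fps_const w * fps_X) oo fps_X ^ 2 = 1 - fps_const w * fps_X ^ 2" for w :: 'a
    by (simp add: fps_compose_sub_distrib fps_compose_mult_distrib)
  then show ?thesis
    by (subst rep_fps_eq_prod) (simp add: fps_compose_prod_distrib)
qed

lemma prod_even_lessThan:
  "(\<Prod>i | i < n \<and> even i. f i) = (\<Prod>j<(n + 1) div 2. f (2 * j))"
  for n :: nat
  by (rule prod.reindex_bij_witness[of _ "\<lambda>j. 2 * j" "\<lambda>i. i div 2"]) auto

lemma prod_odd_lessThan:
  "(\<Prod>i | i < n \<and> odd i. f i) = (\<Prod>j<n div 2. f (Suc (2 * j)))"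
  for n :: nat
  by (rule prod.reindex_bij_witness[of _ "\<lambda>j. Suc (2 * j)" "\<lambda>i. i div 2"]) (auto elim!: oddE)

text \<open>The index \<open>i\<close> stands for the part size \<open>Suc i\<close>, so even
  \<open>i\<close> are the odd sizes, and \<open>(n + 1) div 2\<close> of these are at most
  \<open>n\<close>.\<close>

lemma prod_pair_weight_even:
  "(\<Prod>i | i < n \<and> even i. 1 - fps_const (pair_weight a b c d (Suc i)) * fps_X) =
     fps_qpoch (a * c) (a * b * c * d) ((n + 1) div 2)"
  by (simp add: prod_even_lessThan pair_weight_odd fps_qpoch_def)

lemma prod_pair_weight_odd:
  "(\<Prod>i | i < n \<and> odd i. 1 - fps_const (pair_weight a b c d (Suc i)) * fps_X) =
     fps_qpoch (a * b * c * d) (a * b * c * d) (n div 2)"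
  using pair_weight_even[of a b c d "Suc _"] by (simp add: prod_odd_lessThan fps_qpoch_def)

lemma prod_pair_weight_all:
  "(\<Prod>i | i < n. 1 - fps_const (pair_weight a b c d (Suc i)) * fps_X) =
     fps_qpoch (a * b * c * d) (a * b * c * d) (n div 2) *
     fps_qpoch (a * c) (a * b * c * d) ((n + 1) div 2)"
  unfolding prod_pair_weight_even[symmetric] prod_pair_weight_odd[symmetric]
  by (subst prod.union_disjoint[symmetric]) (auto intro: prod.cong)

section \<open>Expressing \<open>\<Psi>\<close> through \<open>\<Phi>\<close>, and
  \<open>\<Phi>\<close> through distinct odd parts\<close>

text \<open>Forbidding every repetition multiplies by one q-shifted factorial for the even sizes and
  one for the odd sizes. Their coefficients at \<open>k\<close> and \<open>m - k\<close> form the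
  inner sum.\<close>

lemma Psi_eq_sum_Phi:
  fixes a b c d Q :: "'a::field"
  assumes Q: "Q = a * b * c * d" and gen: "\<And>n::nat. 1 \<le> n \<Longrightarrow> Q ^ n \<noteq> 1"
  shows "Psi N M a b c d =
    (\<Sum>m = 0..M div 2. (- 1) ^ m *
       (\<Sum>k = 0..m.
          qbinom Q (int (N div 2)) (int k)
          * qbinom Q (int ((N + 1) div 2)) (int m - int k)
          * (a * c) ^ (m - k)
          * Q powi (int k * (int k + 1 - int m) + int (m choose 2)))
       * Phi N (M - 2 * m) a b c d)"
proof -
  let ?C = "fps_qpoch Q Q (N div 2) * fps_qpoch (a * c) Q ((N + 1) div 2)"
  have coeff: "?C $ m = (- 1) ^ m *
       (\<Sum>k = 0..m.
          qbinom Q (int (N div 2)) (int k)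
          * qbinom Q (int ((N + 1) div 2)) (int m - int k)
          * (a * c) ^ (m - k)
          * Q powi (int k * (int k + 1 - int m) + int (m choose 2)))" for m
    unfolding fps_mult_nth sum_distrib_left
  proof (rule sum.cong[OF refl])
    fix k assume "k \<in> {0..m}"
    then obtain r where m: "m = k + r" by (auto dest: le_Suc_ex)
    \<comment> \<open>Choosing 2 of \<open>k + r\<close> objects; the mixed term
      \<open>k * r\<close> cancels against \<open>k * (k + 1 - m) = k - k * r\<close>, so the
      integer exponent is a natural number.\<close>
    have "m choose 2 = (k choose 2) + (r choose 2) + k * r"
      unfolding m by (induction k) (simp_all add: choose_2_Suc numeral_2_eq_2)
    then have "int k * (int k + 1 - int m) + int (m choose 2) =
        int (k + (k choose 2) + (r choose 2))"
      by (simp add: m algebra_simps)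
    then have "Q powi (int k * (int k + 1 - int m) + int (m choose 2)) =
        Q ^ k * Q ^ (k choose 2) * Q ^ (r choose 2)"
      by (simp only: power_int_of_nat power_add)
    moreover have "int m - int k = int r" "m - k = r" using m by simp_all
    moreover have "(- 1 :: 'a) ^ m = (- 1) ^ k * (- 1) ^ r" by (simp add: m power_add)
    ultimately show "fps_qpoch Q Q (N div 2) $ k * fps_qpoch (a * c) Q ((N + 1) div 2) $ (m - k) =
        (- 1) ^ m * (qbinom Q (int (N div 2)) (int k)
          * qbinom Q (int ((N + 1) div 2)) (int m - int k)
          * (a * c) ^ (m - k)
          * Q powi (int k * (int k + 1 - int m) + int (m choose 2)))"
      by (simp only: qbinomial_theorem[OF gen] fps_nth_Abs_fps power_minus[of Q] power_minus[of "a * c"]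
            ac_simps)
  qed
  have "Psi N M a b c d = rep_fps (\<lambda>_. False) a b c d N $ M"
    by (simp add: rep_fps_def Psi_eq_rep_sum)
  also have "\<dots> = (\<Sum>m = 0..M div 2. ?C $ m * rep_fps (\<lambda>_. True) a b c d N $ (M - 2 * m))"
    by (subst rep_fps_eq_compose)
       (simp only: not_False_eq_True simp_thms prod_pair_weight_all Q fps_compose_X_square_mult_nth)
  also have "\<dots> = (\<Sum>m = 0..M div 2. ?C $ m * Phi N (M - 2 * m) a b c d)"
    by (simp add: rep_fps_def Phi_eq_rep_sum)
  finally show ?thesis unfolding coeff .
qed

text \<open>With \<open>P = even\<close> exactly the odd parts must be distinct. Inverting the
  factor for the \<open>n\<close> odd sizes restores their repetitions; \<open>k\<close> counts the
  pairs of equal odd rows put back.\<close>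

lemma Phi_eq_sum_rep_sum_even:
  fixes a b c d Q :: "'a::field"
  assumes Q: "Q = a * b * c * d" and gen: "\<And>n::nat. 1 \<le> n \<Longrightarrow> Q ^ n \<noteq> 1"
    and n: "1 \<le> n" "n = (N + 1) div 2"
  shows "Phi N M a b c d =
    (\<Sum>k = 0..M div 2. (a * c) ^ k * qbinom Q (int n + int k - 1) (int k) *
       rep_sum even a b c d N (M - 2 * k))"
proof -
  let ?B = "Abs_fps (\<lambda>k. qbinom Q (int n + int k - 1) (int k) * (a * c) ^ k)"
  have "rep_fps even a b c d N = (fps_qpoch (a * c) Q n oo fps_X ^ 2) * rep_fps (\<lambda>_. True) a b c d N"
    by (subst rep_fps_eq_compose) (simp add: prod_pair_weight_even Q n(2))
  then have "(?B oo fps_X ^ 2) * rep_fps even a b c d N =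
      ((fps_qpoch (a * c) Q n * ?B) oo fps_X ^ 2) * rep_fps (\<lambda>_. True) a b c d N"
    by (simp add: fps_compose_mult_distrib ac_simps)
  then have "rep_fps (\<lambda>_. True) a b c d N = (?B oo fps_X ^ 2) * rep_fps even a b c d N"
    by (simp only: qbinomial_theorem_inverse[OF gen n(1)] fps_compose_1 mult_1_left)
  then have "Phi N M a b c d = ((?B oo fps_X ^ 2) * rep_fps even a b c d N) $ M"
    by (simp add: Phi_eq_rep_sum rep_fps_def fps_eq_iff)
  then show ?thesis
    by (simp add: fps_compose_X_square_mult_nth rep_fps_def mult.commute[of "(a * c) ^ _"])
qed

section \<open>Partitions with distinct odd parts: series over the bound on the parts\<close>

text \<open>The number of rows is fixed and \<open>X\<close> marks half the bound on the parts. The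
  scale \<open>s\<close> absorbs the weight \<open>(a * b) ^ N\<close> of a top row of length
  \<open>2 * N\<close>.\<close>

definition even_fps :: "'a::comm_semiring_1 \<Rightarrow> 'a \<Rightarrow> 'a \<Rightarrow> 'a \<Rightarrow> 'a \<Rightarrow> nat \<Rightarrow> 'a fps" where
  "even_fps s a b c d m = Abs_fps (\<lambda>N. s ^ N * rep_sum even a b c d (2 * N) m)"

lemma rep_sum_even_odd:
  "rep_sum even a b c d (Suc (2 * N)) (Suc m) =
    rep_sum even a b c d (2 * N) (Suc m) + a * (a * b) ^ N * rep_sum even c d a b (2 * N) m"
  by (simp add: rep_sum_Suc_Suc row_weight_odd)

lemma rep_sum_even_even:
  "rep_sum even a b c d (2 * Suc N) (Suc m) =
    rep_sum even a b c d (Suc (2 * N)) (Suc m) +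
    (a * b) ^ Suc N * rep_sum even c d a b (2 * Suc N) m"
  using rep_sum_Suc_Suc[of even a b c d "Suc (2 * N)" m] row_weight_even[of a b "Suc N"]
  by simp

lemma even_fps_0: "(1 - fps_const s * fps_X) * even_fps s a b c d 0 = 1"
  for s :: "'a::comm_ring_1"
proof (rule fps_ext)
  fix N show "((1 - fps_const s * fps_X) * even_fps s a b c d 0) $ N = 1 $ N"
    by (cases N) (simp_all add: fps_one_minus_X_mult_nth even_fps_def)
qed

text \<open>The left factor takes differences between the bounds \<open>2 * n\<close> and
  \<open>2 * Suc n\<close>, so only top rows of length \<open>2 * n + 1\<close> or
  \<open>2 * n + 2\<close> remain. The odd length may not recur, so its rows below have bound
  \<open>2 * n\<close>; this lag gives the numerator \<open>1 + asX\<close>.\<close>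

lemma even_fps_Suc:
  fixes s :: "'a::comm_ring_1"
  shows "(1 - fps_const s * fps_X) * even_fps s a b c d (Suc m) =
    (1 - fps_const (- (a * s)) * fps_X) * even_fps (s * (a * b)) c d a b m"
proof (rule fps_ext)
  fix N
  show "((1 - fps_const s * fps_X) * even_fps s a b c d (Suc m)) $ N =
    ((1 - fps_const (- (a * s)) * fps_X) * even_fps (s * (a * b)) c d a b m) $ N"
  proof (cases N)
    case 0
    then show ?thesis by (simp add: fps_one_minus_X_mult_nth even_fps_def)
  next
    case (Suc n)
    then show ?thesis
      by (simp only: fps_one_minus_X_mult_nth even_fps_def fps_nth_Abs_fps
            rep_sum_even_even rep_sum_even_odd)
         (simp add: algebra_simps power_mult_distrib)
  qed
qed

text \<open>Two rows restore the labels and replace \<open>s\<close> by \<open>s * Q\<close>, so the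
  factors collected along the way form four q-shifted factorials. Denominators are multiplied
  out.\<close>

lemma even_fps_eq_prod:
  fixes s a b c d Q :: "'a::comm_ring_1"
  assumes Q: "Q = a * b * c * d" and "\<mu> \<in> {0, 1}"
  shows "fps_qpoch s Q (Suc M) * fps_qpoch (s * (a * b)) Q (M + \<mu>) *
      even_fps s a b c d (2 * M + \<mu>) =
    fps_qpoch (- (a * s)) Q (M + \<mu>) * fps_qpoch (- (a * b * c * s)) Q M"
proof (induction M arbitrary: s)
  case 0
  show ?case
  proof (cases "\<mu> = 0")
    case True
    then show ?thesis by (simp add: fps_qpoch_Suc_left even_fps_0)
  next
    case False
    have "(1 - fps_const s * fps_X) * (1 - fps_const (s * (a * b)) * fps_X) *
        even_fps s a b c d (Suc 0) =
      (1 - fps_const (s * (a * b)) * fps_X) *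
        ((1 - fps_const s * fps_X) * even_fps s a b c d (Suc 0))"
      by (simp only: ac_simps)
    also have "\<dots> = (1 - fps_const (- (a * s)) * fps_X) *
        ((1 - fps_const (s * (a * b)) * fps_X) * even_fps (s * (a * b)) c d a b 0)"
      unfolding even_fps_Suc by (simp only: ac_simps)
    finally show ?thesis
      using False assms(2) by (simp add: fps_qpoch_Suc_left even_fps_0)
  qed
next
  case (Suc M)
  let ?f = "\<lambda>y. 1 - fps_const y * fps_X" and ?e = "even_fps (s * Q) a b c d (2 * M + \<mu>)"
  have sQ: "s * (a * b) * (c * d) = s * Q" by (simp add: Q ac_simps)
  have "?f s * ?f (s * (a * b)) * even_fps s a b c d (2 * Suc M + \<mu>) =
      ?f (s * (a * b)) * (?f s * even_fps s a b c d (Suc (Suc (2 * M + \<mu>))))"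
    by (simp add: ac_simps)
  also have "\<dots> = ?f (- (a * s)) *
      (?f (s * (a * b)) * even_fps (s * (a * b)) c d a b (Suc (2 * M + \<mu>)))"
    unfolding even_fps_Suc[of s] by (simp only: ac_simps)
  also have "\<dots> = ?f (- (a * s)) * (?f (- (c * (s * (a * b)))) * ?e)"
    unfolding even_fps_Suc sQ ..
  finally have two: "?f s * ?f (s * (a * b)) * even_fps s a b c d (2 * Suc M + \<mu>) =
      ?f (- (a * s)) * ?f (- (a * b * c * s)) * ?e"
    by (simp only: ac_simps)
  have "fps_qpoch s Q (Suc (Suc M)) * fps_qpoch (s * (a * b)) Q (Suc M + \<mu>) *
      even_fps s a b c d (2 * Suc M + \<mu>) =
    fps_qpoch (s * Q) Q (Suc M) * fps_qpoch (s * Q * (a * b)) Q (M + \<mu>) *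
      (?f s * ?f (s * (a * b)) * even_fps s a b c d (2 * Suc M + \<mu>))"
    unfolding fps_qpoch_Suc_left[of s] fps_qpoch_Suc_left[of "s * (a * b)"] add_Suc
    by (simp only: ac_simps)
  also have "\<dots> = ?f (- (a * s)) * ?f (- (a * b * c * s)) *
      (fps_qpoch (s * Q) Q (Suc M) * fps_qpoch (s * Q * (a * b)) Q (M + \<mu>) * ?e)"
    unfolding two by (simp only: ac_simps)
  also have "\<dots> = fps_qpoch (- (a * s)) Q (Suc M + \<mu>) * fps_qpoch (- (a * b * c * s)) Q (Suc M)"
    unfolding Suc.IH add_Suc fps_qpoch_Suc_left[of "- (a * s)"]
      fps_qpoch_Suc_left[of "- (a * b * c * s)"]
    by (simp add: ac_simps)
  finally show ?case .
qed

text \<open>The coefficient of \<open>X\<^sup>N\<close> in the product at \<open>s = 1\<close>: the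
  two numerators give \<open>m1\<close> and \<open>m3\<close>, the inverted denominators
  \<open>m2\<close> and \<open>m4\<close>.\<close>

lemma rep_sum_even_eq:
  fixes a b c d Q :: "'a::field"
  assumes Q: "Q = a * b * c * d" and gen: "\<And>n::nat. 1 \<le> n \<Longrightarrow> Q ^ n \<noteq> 1"
    and \<mu>: "\<mu> \<in> {0, 1}" and \<nu>: "\<nu> \<in> {0, 1}" and M: "1 \<le> M + \<mu>"
  shows "rep_sum even a b c d (2 * N + \<nu>) (2 * M + \<mu>) =
    (\<Sum>(m1, m2, m3, m4) \<in> {(m1, m2, m3, m4). m1 + m2 + m3 + m4 = N}.
       qbinom Q (int M + int m4) (int m4)
       * qbinom Q (int M + int \<mu> - int \<nu>) (int m1)
       * (1 + a * of_nat \<nu>) * a ^ m1 * Q ^ ((m1 + \<nu>) choose 2)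
       * qbinom Q (int M + int \<mu> - 1 + int m2) (int m2) * (a * b) ^ m2
       * qbinom Q (int M) (int m3) * (a * b * c) ^ m3 * Q ^ (m3 choose 2))"
proof -
  let ?B = "\<lambda>n y. Abs_fps (\<lambda>k. qbinom Q (int n + int k - 1) (int k) * y ^ k)"
  \<comment> \<open>For \<open>\<nu> = 1\<close> the first numerator factor \<open>1 + aX\<close> is
    dropped, to be replaced by the constant \<open>1 + a\<close>.\<close>
  let ?R = "fps_qpoch (- (a * Q ^ \<nu>)) Q (M + \<mu> - \<nu>)"
  let ?F = "Abs_fps (\<lambda>N. rep_sum even a b c d (2 * N + \<nu>) (2 * M + \<mu>))"
  let ?e = "even_fps 1 a b c d (2 * M + \<mu>)"
  have e: "fps_qpoch 1 Q (Suc M) * fps_qpoch (a * b) Q (M + \<mu>) * ?e =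
      fps_qpoch (- a) Q (M + \<mu>) * fps_qpoch (- (a * b * c)) Q M"
    using even_fps_eq_prod[OF Q \<mu>, of 1 M] by simp
  have F: "fps_qpoch 1 Q (Suc M) * fps_qpoch (a * b) Q (M + \<mu>) * ?F =
      fps_const (1 + a * of_nat \<nu>) * ?R * fps_qpoch (- (a * b * c)) Q M"
  proof (cases "\<nu> = 0")
    case True
    then show ?thesis using e by (simp add: even_fps_def)
  next
    case False
    then have [simp]: "\<nu> = 1" using \<nu> by simp
    obtain m where m: "2 * M + \<mu> = Suc m" using M by (cases "2 * M + \<mu>") auto
    let ?f = "\<lambda>y. 1 - fps_const y * fps_X"
      and ?D = "fps_qpoch 1 Q (Suc M) * fps_qpoch (a * b) Q (M + \<mu>)"
    have "?F = ?e + fps_const a * even_fps (a * b) c d a b m"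
      unfolding m by (rule fps_ext) (simp add: even_fps_def rep_sum_even_odd mult.assoc)
    \<comment> \<open>Multiplied by \<open>1 + aX\<close>, the second summand also becomes a
      multiple of \<open>?e\<close>, and \<open>(1 + aX) + a (1 - X) = 1 + a\<close>.\<close>
    then have "?f (- a) * ?F = ?f (- a) * ?e + fps_const a * (?f (- a) * even_fps (a * b) c d a b m)"
      by (simp only: distrib_left ac_simps)
    also have "?f (- a) * even_fps (a * b) c d a b m = ?f 1 * ?e"
      using even_fps_Suc[of 1 a b c d m] m by simp
    also have "?f (- a) * ?e + fps_const a * (?f 1 * ?e) = (1 + fps_const a) * ?e"
      by (simp add: algebra_simps flip: fps_const_neg)
    finally have "?D * (?f (- a) * ?F) = ?D * ((1 + fps_const a) * ?e)"
      by (rule arg_cong)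
    then have "?f (- a) * (?D * ?F) = (1 + fps_const a) * (?D * ?e)"
      by (simp only: ac_simps)
    also have "\<dots> = ?f (- a) * (fps_const (1 + a) * ?R * fps_qpoch (- (a * b * c)) Q M)"
    proof -
      have "fps_qpoch (- a) Q (M + \<mu>) = ?f (- a) * ?R"
        using fps_qpoch_Suc_left[of "- a" Q "M + \<mu> - 1"] M
        by (simp add: Suc_diff_Suc del: diff_Suc_1 flip: Suc_diff_le)
      then show ?thesis unfolding e by (simp add: ac_simps flip: fps_const_add)
    qed
    finally have "?f (- a) * (?D * ?F) =
        ?f (- a) * (fps_const (1 + a) * ?R * fps_qpoch (- (a * b * c)) Q M)" .
    moreover have "?f (- a) \<noteq> 0"
    proof
      assume "?f (- a) = 0"
      then have "?f (- a) $ 0 = 0" by simp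
      then show False by simp
    qed
    ultimately have "?D * ?F = fps_const (1 + a) * ?R * fps_qpoch (- (a * b * c)) Q M"
      by simp
    then show ?thesis by simp
  qed
  have "?F = (fps_qpoch 1 Q (Suc M) * ?B (Suc M) 1) *
      (fps_qpoch (a * b) Q (M + \<mu>) * ?B (M + \<mu>) (a * b)) * ?F"
    using qbinomial_theorem_inverse[OF gen, of "Suc M" 1]
      qbinomial_theorem_inverse[OF gen M, of "a * b"]
    by (simp del: of_nat_Suc of_nat_add)
  also have "\<dots> = ?B (Suc M) 1 * ?B (M + \<mu>) (a * b) *
      (fps_qpoch 1 Q (Suc M) * fps_qpoch (a * b) Q (M + \<mu>) * ?F)"
    by (simp only: ac_simps)
  also have "\<dots> = fps_const (1 + a * of_nat \<nu>) *
      (?R * ?B (M + \<mu>) (a * b) * fps_qpoch (- (a * b * c)) Q M * ?B (Suc M) 1)"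
    unfolding F by (simp only: ac_simps)
  finally have "?F $ N = (fps_const (1 + a * of_nat \<nu>) *
      (?R * ?B (M + \<mu>) (a * b) * fps_qpoch (- (a * b * c)) Q M * ?B (Suc M) 1)) $ N"
    by (rule arg_cong)
  moreover have R: "fps_qpoch (- y) Q n $ k = qbinom Q (int n) (int k) * y ^ k * Q ^ (k choose 2)"
    for y n k
    using qbinomial_theorem[OF gen, of "- y" n] by simp
  moreover have "?R $ k = qbinom Q (int M + int \<mu> - int \<nu>) (int k) * a ^ k *
      Q ^ ((k + \<nu>) choose 2)" for k
  proof -
    have "(a * Q ^ \<nu>) ^ k * Q ^ (k choose 2) = a ^ k * Q ^ ((k + \<nu>) choose 2)"
      using \<nu> by (auto simp: choose_2_Suc power_mult_distrib power_add)
    moreover have "int (M + \<mu> - \<nu>) = int M + int \<mu> - int \<nu>" using \<nu> M by auto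
    ultimately show ?thesis by (simp only: R mult.assoc)
  qed
  moreover have "?B (Suc M) 1 $ k = qbinom Q (int M + int k) (int k)"
    and "?B (M + \<mu>) (a * b) $ k = qbinom Q (int M + int \<mu> - 1 + int k) (int k) * (a * b) ^ k" for k
    by (simp_all add: algebra_simps)
  ultimately show ?thesis
    by (simp only: fps_mult_left_const_nth fps_mult4_nth sum_distrib_left)
       (auto simp: ac_simps intro!: sum.cong)
qed

section \<open>Assembling both identities\<close>

theorem theorem4p7:
  fixes a b c d Q :: "'a::field"
  assumes Q_def: "Q = a * b * c * d"
    and Q_generic: "\<And>n::nat. 1 \<le> n \<Longrightarrow> Q ^ n \<noteq> 1"
  shows
    "(\<forall>(N::nat) (M::nat) (\<nu>::nat) (\<mu>::nat). \<nu> \<in> {0, 1} \<and> \<mu> \<in> {0, 1} \<and> N + \<nu> \<ge> 1 \<longrightarrow>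
        Phi (2 * N + \<nu>) (2 * M + \<mu>) a b c d =
          (if \<mu> = 0 then 1 else 0) * (a * c) ^ M * qbinom Q (int N + int M + int \<nu> - 1) (int M)
          + (\<Sum>k \<in> {k::nat. int k \<le> int M + int \<mu> - 1}.
               (a * c) ^ k * qbinom Q (int N + int k + int \<nu> - 1) (int k) *
               (\<Sum>(m1, m2, m3, m4) \<in>
                   {(m1::nat, m2::nat, m3::nat, m4::nat). m1 + m2 + m3 + m4 = N}.
                  qbinom Q (int M - int k + int m4) (int m4)
                  * qbinom Q (int M - int k + int \<mu> - int \<nu>) (int m1)
                  * (1 + a * of_nat \<nu>) * a ^ m1 * Q ^ ((m1 + \<nu>) choose 2)
                  * qbinom Q (int M - int k + int \<mu> - 1 + int m2) (int m2) * (a * b) ^ m2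
                  * qbinom Q (int M - int k) (int m3) * (a * b * c) ^ m3 * Q ^ (m3 choose 2))))
     \<and>
     (\<forall>(N::nat) (M::nat).
        Psi N M a b c d =
          (\<Sum>m = 0..M div 2. (- 1) ^ m *
             (\<Sum>k = 0..m.
                qbinom Q (int (N div 2)) (int k)
                * qbinom Q (int ((N + 1) div 2)) (int m - int k)
                * (a * c) ^ (m - k)
                * Q powi (int k * (int k + 1 - int m) + int (m choose 2)))
             * Phi N (M - 2 * m) a b c d))"
proof (intro conjI allI impI, goal_cases)
  case (1 N M \<nu> \<mu>)
  then have \<nu>: "\<nu> \<in> {0, 1}" and \<mu>: "\<mu> \<in> {0, 1}" and N: "1 \<le> N + \<nu>"
    by auto
  let ?t = "\<lambda>k. (a * c) ^ k * qbinom Q (int (N + \<nu>) + int k - 1) (int k) *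
      rep_sum even a b c d (2 * N + \<nu>) (2 * M + \<mu> - 2 * k)"
  let ?S = "\<lambda>k. \<Sum>(m1, m2, m3, m4) \<in>
                   {(m1::nat, m2::nat, m3::nat, m4::nat). m1 + m2 + m3 + m4 = N}.
                  qbinom Q (int M - int k + int m4) (int m4)
                  * qbinom Q (int M - int k + int \<mu> - int \<nu>) (int m1)
                  * (1 + a * of_nat \<nu>) * a ^ m1 * Q ^ ((m1 + \<nu>) choose 2)
                  * qbinom Q (int M - int k + int \<mu> - 1 + int m2) (int m2) * (a * b) ^ m2
                  * qbinom Q (int M - int k) (int m3) * (a * b * c) ^ m3 * Q ^ (m3 choose 2)"
  \<comment> \<open>The integer comparison makes this set empty for \<open>M = \<mu> = 0\<close>; in
    general it says that \<open>M - k + \<mu>\<close> is at least 1.\<close>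
  let ?K = "{k::nat. int k \<le> int M + int \<mu> - 1}"
  have S: "rep_sum even a b c d (2 * N + \<nu>) (2 * M + \<mu> - 2 * k) = ?S k" if "k \<in> ?K" for k
  proof -
    have k: "k \<le> M" "1 \<le> M - k + \<mu>" "2 * M + \<mu> - 2 * k = 2 * (M - k) + \<mu>"
      using that \<mu> by auto
    show ?thesis
      using rep_sum_even_eq[OF Q_def Q_generic \<mu> \<nu> k(2), of N]
      unfolding k(3) of_nat_diff[OF k(1)] .
  qed
  \<comment> \<open>There are \<open>N + \<nu>\<close> odd sizes up to
    \<open>2 * N + \<nu>\<close>.\<close>
  have "Phi (2 * N + \<nu>) (2 * M + \<mu>) a b c d = (\<Sum>k = 0..(2 * M + \<mu>) div 2. ?t k)"
    using \<nu> by (intro Phi_eq_sum_rep_sum_even[OF Q_def Q_generic N]) auto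
  \<comment> \<open>For \<open>\<mu> = 0\<close> the term \<open>k = M\<close> leaves no rows, so
    its \<open>rep_sum\<close> is 1; it becomes the Kronecker term.\<close>
  also have "\<dots> = (if \<mu> = 0 then ?t M else 0) + (\<Sum>k \<in> ?K. ?t k)"
  proof (cases "\<mu> = 0")
    case True
    then have "{0..(2 * M + \<mu>) div 2} = insert M ?K" "M \<notin> ?K" "finite ?K"
      by (auto intro: finite_subset[of _ "{..M}"])
    with True show ?thesis by simp
  next
    case False
    then have "{0..(2 * M + \<mu>) div 2} = ?K" using \<mu> by auto
    with False show ?thesis by simp
  qed
  also have "(\<Sum>k \<in> ?K. ?t k) =
      (\<Sum>k \<in> ?K. (a * c) ^ k * qbinom Q (int N + int k + int \<nu> - 1) (int k) * ?S k)"
    by (intro sum.cong refl) (simp only: S, simp add: ac_simps)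
  also have "(if \<mu> = 0 then ?t M else 0) = (if \<mu> = 0 then 1 else 0) * (a * c) ^ M *
      qbinom Q (int N + int M + int \<nu> - 1) (int M)"
    by (simp add: ac_simps)
  finally show ?case .
next
  case (2 N M)
  show ?case by (rule Psi_eq_sum_Phi[OF Q_def Q_generic])
qed

end
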